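(* Let $X$ be a two-dimensional one-step shift of finite type. Then $X$ has a horizontally periodic point if and only if $X$ has an $(m,n)$-periodic point for some $m,n\in\mathbb{Z}\setminus\{0\}$.
   Context: Let $\mathcal{A}$ be a finite alphabet. A two-dimensional shift space is a set $X_{\mathcal{F}}\subseteq \mathcal{A}^{\mathbb{Z}^2}$ consisting of all $x\in\mathcal{A}^{\mathbb{Z}^2}$ in which no translate of a pattern from a given set $\mathcal{F}$ of finite patterns appears; it is of finite type if $\mathcal{F}$ can be chosen to be finite. It is a one-step shift if $\mathcal{F}$ can be chosen to consist only of pairs of horizontally adjacent symbols and pairs of vertically adjacent symbols. For $u\in\mathbb{Z}^2\setminus\{0\}$, a point $x\in X$ is $u$-periodic if $x(v+u)=x(v)$ for all $v\in\mathbb{Z}^2$. A point is horizontally periodic if it is $(m,0)$-periodic for some $m\neq 0$. *)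

theory Defs
  imports Main "HOL-Library.Product_Plus"
begin

text \<open>
  The lattice of integer pairs is \<open>int \<times> int\<close> with componentwise addition, and a configuration
  is a map \<open>int \<times> int \<Rightarrow> 'a\<close>.  The alphabet is an explicit set \<open>A\<close>; its finiteness is assumed
  where it is needed.
\<close>

definition configurations :: "'a set \<Rightarrow> (int \<times> int \<Rightarrow> 'a) set" where
  "configurations A = {x. range x \<subseteq> A}"

text \<open>A finite pattern is a map from a finite set of positions (its domain) to the alphabet.\<close>

definition finite_pattern :: "'a set \<Rightarrow> (int \<times> int \<rightharpoonup> 'a) \<Rightarrow> bool" where
  "finite_pattern A p \<longleftrightarrow> finite (dom p) \<and> ran p \<subseteq> A"

definition appears_in :: "(int \<times> int \<rightharpoonup> 'a) \<Rightarrow> (int \<times> int \<Rightarrow> 'a) \<Rightarrow> bool" where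
  "appears_in p x \<longleftrightarrow> (\<exists>t. \<forall>v\<in>dom p. p v = Some (x (v + t)))"

definition shift_avoiding ::
  "'a set \<Rightarrow> (int \<times> int \<rightharpoonup> 'a) set \<Rightarrow> (int \<times> int \<Rightarrow> 'a) set" where
  "shift_avoiding A F = {x \<in> configurations A. \<forall>p\<in>F. \<not> appears_in p x}"

definition shift_of_finite_type :: "'a set \<Rightarrow> (int \<times> int \<Rightarrow> 'a) set \<Rightarrow> bool" where
  "shift_of_finite_type A X \<longleftrightarrow>
     (\<exists>F. finite F \<and> (\<forall>p\<in>F. finite_pattern A p) \<and> X = shift_avoiding A F)"

definition horizontal_pair :: "'a set \<Rightarrow> (int \<times> int \<rightharpoonup> 'a) \<Rightarrow> bool" where
  "horizontal_pair A p \<longleftrightarrow> (\<exists>v. \<exists>a\<in>A. \<exists>b\<in>A. p = [v \<mapsto> a, v + (1, 0) \<mapsto> b])"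

definition vertical_pair :: "'a set \<Rightarrow> (int \<times> int \<rightharpoonup> 'a) \<Rightarrow> bool" where
  "vertical_pair A p \<longleftrightarrow> (\<exists>v. \<exists>a\<in>A. \<exists>b\<in>A. p = [v \<mapsto> a, v + (0, 1) \<mapsto> b])"

definition one_step_shift :: "'a set \<Rightarrow> (int \<times> int \<Rightarrow> 'a) set \<Rightarrow> bool" where
  "one_step_shift A X \<longleftrightarrow>
     (\<exists>F. (\<forall>p\<in>F. horizontal_pair A p \<or> vertical_pair A p) \<and> X = shift_avoiding A F)"

definition periodic_point :: "int \<times> int \<Rightarrow> (int \<times> int \<Rightarrow> 'a) \<Rightarrow> bool" where
  "periodic_point u x \<longleftrightarrow> u \<noteq> 0 \<and> (\<forall>v. x (v + u) = x v)"

definition horizontally_periodic :: "(int \<times> int \<Rightarrow> 'a) \<Rightarrow> bool" where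
  "horizontally_periodic x \<longleftrightarrow> (\<exists>m. m \<noteq> 0 \<and> periodic_point (m, 0) x)"

end

theory Submission imports Defs "HOL-Library.FuncSet" begin

text \<open>
  Membership in a one-step shift only depends on which horizontally and which vertically adjacent
  pairs of symbols occur.  Both implications follow from one construction that preserves
  membership for this reason: a point with period \<open>(m, n)\<close>, \<open>n > 0\<close>, can be rearranged into a
  point that has the period \<open>(m, n)\<close> and in addition a horizontal period \<open>(p, 0)\<close>.

  The point is determined by the strip of rows \<open>0, \<dots>, n - 1\<close>; the row above the strip is the
  bottom row shifted by \<open>m\<close>.  Since the alphabet is finite, two windows of this strip, of width
  \<open>2 * \<bar>m\<bar> + 1\<close> and centred at columns \<open>i < j\<close>, carry the same symbols.  Repeating the columns
  \<open>i, \<dots>, j - 1\<close> of the strip with period \<open>p = j - i\<close> and extending by the period \<open>(m, n)\<close> gives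
  the new point.  A vertical pair that crosses the top of the strip compares columns at distance
  \<open>\<bar>m\<bar>\<close>, and equality of the windows is what makes such a pair occur already in the old point.

  This gives a horizontally periodic point from an \<open>(m, n)\<close>-periodic one.  For the converse, the
  transpose of an \<open>(m, 0)\<close>-periodic point has period \<open>(0, m)\<close>; the construction, transposed back,
  yields the periods \<open>(m, 0)\<close> and \<open>(0, p)\<close>, hence \<open>(m, p)\<close>.
\<close>

definition adjacent_pairs_occur_in ::
  "(int \<times> int \<Rightarrow> 'a) \<Rightarrow> (int \<times> int \<Rightarrow> 'a) \<Rightarrow> bool" where
  "adjacent_pairs_occur_in y x \<longleftrightarrow>
     (\<forall>v. \<forall>d\<in>{(1, 0), (0, 1)}. \<exists>w. y v = x w \<and> y (v + d) = x (w + d))"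

lemma adjacent_pairs_occur_in_swap:
  assumes "adjacent_pairs_occur_in y (x \<circ> prod.swap)"
  shows "adjacent_pairs_occur_in (y \<circ> prod.swap) x"
  unfolding adjacent_pairs_occur_in_def
proof (intro allI ballI)
  fix v d :: "int \<times> int"
  assume "d \<in> {(1, 0), (0, 1)}"
  then have "prod.swap d \<in> {(1, 0), (0, 1)}" by auto
  then obtain w where "y (prod.swap v) = x (prod.swap w)"
    "y (prod.swap v + prod.swap d) = x (prod.swap (w + prod.swap d))"
    using assms unfolding adjacent_pairs_occur_in_def by (metis comp_apply)
  then show "\<exists>w. (y \<circ> prod.swap) v = x w \<and> (y \<circ> prod.swap) (v + d) = x (w + d)"
    by (intro exI[of _ "prod.swap w"]) (auto simp: prod.swap_def plus_prod_def)
qed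

lemma appears_in_transfer:
  assumes occur: "adjacent_pairs_occur_in y x"
    and p: "p = [v \<mapsto> a, v + d \<mapsto> b]" and d: "d \<in> {(1, 0), (0, 1)}"
    and "appears_in p y"
  shows "appears_in p x"
proof -
  have ne: "v + d \<noteq> v" using d by (auto simp: zero_prod_def)
  obtain t where t: "\<forall>u\<in>dom p. p u = Some (y (u + t))"
    using \<open>appears_in p y\<close> by (auto simp: appears_in_def)
  have "a = y (v + t)" "b = y (v + d + t)"
    using t[THEN bspec, of v] t[THEN bspec, of "v + d"] p ne by auto
  moreover obtain w where "y (v + t) = x w" "y (v + t + d) = x (w + d)"
    using occur d unfolding adjacent_pairs_occur_in_def by blast
  ultimately have "a = x (v + (w - v))" "b = x (v + d + (w - v))"
    by (simp_all add: algebra_simps)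
  then have "\<forall>u\<in>dom p. p u = Some (x (u + (w - v)))"
    using p ne by auto
  then show ?thesis unfolding appears_in_def by blast
qed

lemma one_step_shift_closed:
  assumes X: "one_step_shift A X" and x: "x \<in> X"
    and occur: "adjacent_pairs_occur_in y x"
  shows "y \<in> X"
proof -
  obtain F where F: "\<And>p. p \<in> F \<Longrightarrow> horizontal_pair A p \<or> vertical_pair A p"
    and XF: "X = shift_avoiding A F"
    using X by (auto simp: one_step_shift_def)
  have xA: "range x \<subseteq> A" and xF: "\<And>p. p \<in> F \<Longrightarrow> \<not> appears_in p x"
    using x by (auto simp: XF shift_avoiding_def configurations_def)
  have "y v \<in> A" for v
    using occur xA unfolding adjacent_pairs_occur_in_def by (metis insertI1 rangeI subsetD)
  moreover have "\<not> appears_in p y" if "p \<in> F" for p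
  proof -
    obtain v a b d where "p = [v \<mapsto> a, v + d \<mapsto> b]" "d \<in> {(1, 0), (0, 1)}"
      using F[OF \<open>p \<in> F\<close>] unfolding horizontal_pair_def vertical_pair_def by blast
    then show ?thesis using appears_in_transfer[OF occur] xF[OF \<open>p \<in> F\<close>] by blast
  qed
  ultimately show ?thesis by (auto simp: XF shift_avoiding_def configurations_def)
qed

lemma periodic_point_uminus:
  assumes "periodic_point u x"
  shows "periodic_point (- u) x"
proof -
  have "x (v + - u) = x v" for v
    using assms[unfolded periodic_point_def, THEN conjunct2, rule_format, of "v - u"] by simp
  then show ?thesis using assms by (simp add: periodic_point_def)
qed

text \<open>
  If \<open>h\<close> takes the same values on the windows of radius \<open>M\<close> around \<open>0\<close> and around \<open>p\<close>, then it is
  \<open>p\<close>-periodic along the whole stretch that the two windows span, even if \<open>M\<close> exceeds \<open>p\<close> and the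
  windows overlap.
\<close>

lemma mod_eq_of_equal_windows:
  fixes h :: "int \<Rightarrow> 'b"
  assumes p: "0 < p" and window: "\<And>t. - M \<le> t \<Longrightarrow> t \<le> M \<Longrightarrow> h (t + p) = h t"
    and "0 \<le> M" "- M \<le> u" "u \<le> p + M"
  shows "h (u mod p) = h u"
  using \<open>- M \<le> u\<close> \<open>u \<le> p + M\<close>
  \<comment> \<open>The measure is the distance of \<open>u\<close> from the fundamental interval \<open>{0..<p}\<close>.\<close>
proof (induction "nat (max (- u) (u - p + 1))" arbitrary: u rule: less_induct)
  case less
  consider "u < 0" | "0 \<le> u" "u < p" | "p \<le> u" by linarith
  then show ?case
  proof cases
    case 1
    have "h ((u + p) mod p) = h (u + p)"
      by (rule less.hyps) (use 1 p \<open>0 \<le> M\<close> less.prems in auto)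
    moreover have "h (u + p) = h u"
      by (rule window) (use 1 \<open>0 \<le> M\<close> less.prems in auto)
    ultimately show ?thesis by simp
  next
    case 2
    then show ?thesis by simp
  next
    case 3
    have "h ((u - p) mod p) = h (u - p)"
      by (rule less.hyps) (use 3 p \<open>0 \<le> M\<close> less.prems in auto)
    moreover have "h (u - p + p) = h (u - p)"
      by (rule window) (use 3 \<open>0 \<le> M\<close> less.prems in auto)
    ultimately show ?thesis by simp
  qed
qed

text \<open>
  Pigeonhole: a window has only finitely many possible contents, but there are infinitely many
  columns at which it can be centred.
\<close>

lemma repeated_window:
  fixes x :: "int \<times> int \<Rightarrow> 'a"
  assumes "finite (range x)"
  obtains i p where "0 < p"
    "\<And>t b. - M \<le> t \<Longrightarrow> t \<le> M \<Longrightarrow> 0 \<le> b \<Longrightarrow> b < n \<Longrightarrow> x (i + (t + p), b) = x (i + t, b)"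
proof -
  let ?W = "{- M..M} \<times> {0..<n}"
  define f where "f i = restrict (\<lambda>(t, b). x (i + t, b)) ?W" for i :: int
  have "range f \<subseteq> (\<Pi>\<^sub>E w\<in>?W. range x)" by (auto simp: f_def PiE_def extensional_def)
  moreover have "finite (\<Pi>\<^sub>E w\<in>?W. range x)" by (intro finite_PiE) (use assms in auto)
  ultimately have "finite (range f)" by (rule finite_subset)
  then have "\<not> inj f" using finite_imageD infinite_UNIV_int by blast
  then obtain i j where "i < j" and eq: "f i = f j"
    unfolding inj_def by (metis linorder_neqE)
  show thesis
  proof (rule that[of "j - i" i])
    show "0 < j - i" using \<open>i < j\<close> by simp
    fix t b
    assume "- M \<le> t" "t \<le> M" "0 \<le> b" "b < n"
    then have "f j (t, b) = x (j + t, b)" "f i (t, b) = x (i + t, b)" by (auto simp: f_def)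
    then show "x (i + (t + (j - i)), b) = x (i + t, b)" using eq by (simp add: algebra_simps)
  qed
qed

text \<open>
  The construction behind both implications.  The shear \<open>m\<close> may be \<open>0\<close>, which is the case that
  the transposed application needs.
\<close>

lemma exists_doubly_periodic:
  fixes x :: "int \<times> int \<Rightarrow> 'a"
  assumes fin: "finite (range x)" and "0 < n" and per: "periodic_point (m, n) x"
  obtains y p where "0 < p" "periodic_point (p, 0) y" "periodic_point (m, n) y"
    "adjacent_pairs_occur_in y x"
proof -
  obtain i p where p: "0 < p"
    and window: "\<And>t b. - \<bar>m\<bar> \<le> t \<Longrightarrow> t \<le> \<bar>m\<bar> \<Longrightarrow> 0 \<le> b \<Longrightarrow> b < n
      \<Longrightarrow> x (i + (t + p), b) = x (i + t, b)"
    using repeated_window[OF fin] by metis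
  have fold: "x (i + u mod p, b) = x (i + u, b)"
    if "- \<bar>m\<bar> \<le> u" "u \<le> p + \<bar>m\<bar>" "0 \<le> b" "b < n" for u b
    using mod_eq_of_equal_windows[of p "\<bar>m\<bar>" "\<lambda>u. x (i + u, b)" u] p window that by simp
  have xper: "x (a + m, b + n) = x (a, b)" for a b
    using per by (auto simp: periodic_point_def)
  \<comment> \<open>\<open>k\<close> is the column, counted from \<open>i\<close>, reached from \<open>(a, b)\<close> by the multiple of \<open>(m, n)\<close>
    that leads into the strip, followed by a multiple of \<open>(p, 0)\<close>.\<close>
  define k where "k a b = (a - m * (b div n) - i) mod p" for a b
  define y where "y = (\<lambda>(a, b). x (i + k a b, b mod n))"
  have k: "0 \<le> k a b" "k a b < p" for a b using p by (auto simp: k_def)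
  have r: "0 \<le> b mod n" "b mod n < n" for b using \<open>0 < n\<close> by auto
  have "k (a + p) b = k a b" for a b
  proof -
    have "a + p - m * (b div n) - i = (a - m * (b div n) - i) + p" by simp
    then show ?thesis unfolding k_def by (simp only: mod_add_self2)
  qed
  then have "periodic_point (p, 0) y"
    using p by (auto simp: periodic_point_def y_def zero_prod_def)
  moreover have "k (a + m) (b + n) = k a b" for a b
  proof -
    have "(b + n) div n = b div n + 1" using \<open>0 < n\<close> by (simp add: div_add_self2)
    then show ?thesis by (simp add: k_def algebra_simps)
  qed
  then have "periodic_point (m, n) y"
    using \<open>0 < n\<close> by (auto simp: periodic_point_def y_def zero_prod_def)
  moreover have "\<exists>w. y (a, b) = x w \<and> y (a + 1, b) = x (w + (1, 0))" for a b
  proof -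
    have "k (a + 1) b = (k a b + 1) mod p"
      by (simp add: k_def mod_simps algebra_simps)
    then have "y (a + 1, b) = x (i + (k a b + 1), b mod n)"
      using fold[of "k a b + 1" "b mod n"] k[of a b] r[of b] by (simp add: y_def)
    then show ?thesis
      by (intro exI[of _ "(i + k a b, b mod n)"]) (simp add: y_def algebra_simps)
  qed
  moreover have "\<exists>w. y (a, b) = x w \<and> y (a, b + 1) = x (w + (0, 1))" for a b
  proof (cases "b mod n = n - 1")
    case False
    have "b + 1 = n * (b div n) + (b mod n + 1)" "0 \<le> b mod n + 1" "b mod n + 1 < n"
      using False r[of b] by auto
    then have "(b + 1) div n = b div n" "(b + 1) mod n = b mod n + 1"
      by (rule int_div_pos_eq, rule int_mod_pos_eq)
    then show ?thesis
      by (intro exI[of _ "(i + k a b, b mod n)"]) (simp add: y_def k_def)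
  next
    \<comment> \<open>The pair crosses the top of the strip.  The period \<open>(m, n)\<close> lifts its upper cell to row \<open>n\<close>
      of the old point, at column \<open>s + m\<close>; the lower cell folds back from that same column, which
      lies at most \<open>\<bar>m\<bar>\<close> outside the repeated block.\<close>
    case True
    define s where "s = k a (b + 1)"
    have "b = b div n * n + (n - 1)" using True div_mult_mod_eq[of b n] by metis
    then have "b + 1 = (b div n + 1) * n" unfolding distrib_right by linarith
    then have above: "(b + 1) div n = b div n + 1" "(b + 1) mod n = 0"
      using \<open>0 < n\<close> by auto
    then have "(s + m) mod p = k a b"
      by (simp add: s_def k_def mod_simps algebra_simps)
    then have "y (a, b) = x (i + (s + m), n - 1)"
      using fold[of "s + m" "n - 1"] k[of a "b + 1"] \<open>0 < n\<close> True
      by (simp add: y_def s_def)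
    moreover have "y (a, b + 1) = x (i + (s + m), n)"
      using xper[of "i + s" 0] above by (simp add: y_def s_def algebra_simps)
    ultimately show ?thesis
      by (intro exI[of _ "(i + (s + m), n - 1)"]) simp
  qed
  ultimately show thesis
    using p by (intro that[of p y]) (auto simp: adjacent_pairs_occur_in_def)
qed

theorem proposition4:
  fixes A :: "'a set" and X :: "(int \<times> int \<Rightarrow> 'a) set"
  assumes "finite A"
    and "shift_of_finite_type A X"
    and "one_step_shift A X"
  shows "(\<exists>x\<in>X. horizontally_periodic x) \<longleftrightarrow>
         (\<exists>m n. m \<noteq> 0 \<and> n \<noteq> 0 \<and> (\<exists>x\<in>X. periodic_point (m, n) x))"
proof
  have fin: "finite (range x)" if "x \<in> X" for x
    using assms that finite_subset
    by (auto simp: one_step_shift_def shift_avoiding_def configurations_def)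
  {
    assume "\<exists>x\<in>X. horizontally_periodic x"
    then obtain x m0 where x: "x \<in> X" and "m0 \<noteq> 0" "periodic_point (m0, 0) x"
      by (auto simp: horizontally_periodic_def)
    then obtain m where "0 < m" and per: "periodic_point (m, 0) x"
      using periodic_point_uminus[of "(m0, 0)" x] by (cases "0 < m0") force+
    have "periodic_point (0, m) (x \<circ> prod.swap)"
      using per by (auto simp: periodic_point_def zero_prod_def)
    moreover have "finite (range (x \<circ> prod.swap))"
      using fin[OF x] by (rule finite_subset[rotated]) auto
    ultimately obtain y p where "0 < p" and y: "periodic_point (p, 0) y" "periodic_point (0, m) y"
      and occur: "adjacent_pairs_occur_in y (x \<circ> prod.swap)"
      using exists_doubly_periodic \<open>0 < m\<close> by metis
    have "y (a + p, b + m) = y (a, b)" for a b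
    proof -
      have "y ((a + p, b) + (0, m)) = y ((a, b) + (p, 0))"
        using y by (simp add: periodic_point_def)
      then show ?thesis using y by (simp add: periodic_point_def)
    qed
    then have "periodic_point (m, p) (y \<circ> prod.swap)"
      using \<open>0 < p\<close> by (auto simp: periodic_point_def zero_prod_def)
    moreover have "y \<circ> prod.swap \<in> X"
      using one_step_shift_closed[OF assms(3) x adjacent_pairs_occur_in_swap[OF occur]] .
    ultimately show "\<exists>m n. m \<noteq> 0 \<and> n \<noteq> 0 \<and> (\<exists>x\<in>X. periodic_point (m, n) x)"
      using \<open>0 < m\<close> \<open>0 < p\<close> by (metis less_irrefl)
  next
    assume "\<exists>m n. m \<noteq> 0 \<and> n \<noteq> 0 \<and> (\<exists>x\<in>X. periodic_point (m, n) x)"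
    then obtain m0 n0 x where x: "x \<in> X" and "n0 \<noteq> 0" "periodic_point (m0, n0) x" by auto
    then obtain m n where "0 < n" "periodic_point (m, n) x"
      using periodic_point_uminus[of "(m0, n0)" x] by (cases "0 < n0") force+
    then obtain y p where "0 < p" "periodic_point (p, 0) y" "adjacent_pairs_occur_in y x"
      using exists_doubly_periodic[OF fin[OF x]] by metis
    then show "\<exists>x\<in>X. horizontally_periodic x"
      using one_step_shift_closed[OF assms(3) x] unfolding horizontally_periodic_def
      by (metis less_irrefl)
  }
qed

end
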